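(* For every integer $d\geq 10$, the surface $$D'_d:\quad f'_d=x^{d-1}z+y^d+x^{d-2}yw+x^{d-5}y^5=0$$ in $\mathbb{P}^3$ is free with exponents $(1,4,d-6)$.
   Context: $S=\mathbb{C}[x,y,z,w]$ is the standard graded coordinate ring of $\mathbb{P}^3$. For homogeneous $f\in S$, $AR(f)=\{(a_0,a_1,a_2,a_3)\in S^4: a_0f_x+a_1f_y+a_2f_z+a_3f_w=0\}$, graded by the degree of the components, where $f_x,f_y,f_z,f_w$ are the partial derivatives. A reduced surface $D:f=0$ is free if $AR(f)$ is a free graded $S$-module (of rank 3); the degrees of a homogeneous basis are its exponents. *)

theory Defs
  imports
    "HOL-Analysis.Analysis"
    "HOL-Library.Poly_Mapping"
    "HOL-Computational_Algebra.Squarefree"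
begin

text \<open>The variables \<open>x, y, z, w\<close> are indexed by \<open>1, 2, 3, 4\<close> of the numeral type \<open>4\<close>
  (where \<open>4 = 0\<close>). A monomial is its exponent vector, and multiplication on
  \<^typ>\<open>(4 \<Rightarrow>\<^sub>0 nat) \<Rightarrow>\<^sub>0 complex\<close> is convolution, i.e. the product of polynomials.\<close>

type_synonym mpoly4 = "(4 \<Rightarrow>\<^sub>0 nat) \<Rightarrow>\<^sub>0 complex"

definition var :: "4 \<Rightarrow> mpoly4" where
  "var i = Poly_Mapping.single (Poly_Mapping.single i 1) 1"

abbreviation "X \<equiv> var 1"
abbreviation "Y \<equiv> var 2"
abbreviation "Z \<equiv> var 3"
abbreviation "W \<equiv> var 4"

text \<open>If variable \<open>i\<close> does not occur in \<open>m\<close>, the exponent subtraction below truncates,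
  but then the coefficient is \<open>0\<close>.\<close>

definition partial_deriv :: "4 \<Rightarrow> mpoly4 \<Rightarrow> mpoly4" where
  "partial_deriv i p =
    (\<Sum>m\<in>Poly_Mapping.keys p.
       Poly_Mapping.single (m - Poly_Mapping.single i 1)
         (of_nat (Poly_Mapping.lookup m i) * Poly_Mapping.lookup p m))"

text \<open>The zero polynomial is homogeneous of every degree.\<close>

definition homogeneous_poly :: "nat \<Rightarrow> mpoly4 \<Rightarrow> bool" where
  "homogeneous_poly k p \<longleftrightarrow>
    (\<forall>m\<in>Poly_Mapping.keys p. (\<Sum>i\<in>UNIV. Poly_Mapping.lookup m i) = k)"

definition homogeneous_vec :: "nat \<Rightarrow> mpoly4 ^ 4 \<Rightarrow> bool" where
  "homogeneous_vec k a \<longleftrightarrow> (\<forall>i. homogeneous_poly k (a $ i))"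

definition AR :: "mpoly4 \<Rightarrow> (mpoly4 ^ 4) set" where
  "AR f = {a. (\<Sum>i\<in>UNIV. a $ i * partial_deriv i f) = 0}"

interpretation mpoly4_vec: module "(*s) :: mpoly4 \<Rightarrow> mpoly4 ^ 4 \<Rightarrow> mpoly4 ^ 4"
  by unfold_locales (simp_all add: vec_eq_iff algebra_simps)

lemma subspace_AR: "mpoly4_vec.subspace (AR f)"
  by (rule mpoly4_vec.subspaceI)
    (simp_all add: AR_def distrib_right sum.distrib mult.assoc flip: sum_distrib_left)

text \<open>\<open>bs\<close> is a basis of the graded submodule \<open>M\<close> consisting of homogeneous elements, and
  \<open>es\<close> lists their degrees. Members of a basis are nonzero, so their degrees are unique.\<close>

definition homogeneous_basis ::
  "(mpoly4 ^ 4) set \<Rightarrow> (mpoly4 ^ 4) list \<Rightarrow> nat list \<Rightarrow> bool" where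
  "homogeneous_basis M bs es \<longleftrightarrow>
    distinct bs \<and> mpoly4_vec.independent (set bs) \<and> mpoly4_vec.span (set bs) = M \<and>
    list_all2 homogeneous_vec es bs"

definition reduced_surface :: "mpoly4 \<Rightarrow> bool" where
  "reduced_surface f \<longleftrightarrow> (\<exists>k>0. homogeneous_poly k f) \<and> squarefree f"

definition free_surface :: "mpoly4 \<Rightarrow> bool" where
  "free_surface f \<longleftrightarrow>
    reduced_surface f \<and> (\<exists>bs es. length bs = 3 \<and> homogeneous_basis (AR f) bs es)"

definition has_exponents :: "mpoly4 \<Rightarrow> nat list \<Rightarrow> bool" where
  "has_exponents f es \<longleftrightarrow> (\<exists>bs. homogeneous_basis (AR f) bs es)"

definition surface_poly :: "nat \<Rightarrow> mpoly4" where
  "surface_poly d = X ^ (d - 1) * Z + Y ^ d + X ^ (d - 2) * Y * W + X ^ (d - 5) * Y ^ 5"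

end

theory Submission
  imports Defs
begin

text \<open>
  Write \<open>d = n + 10\<close> and \<open>f\<close> for the equation of the surface. Everything rests on divisibility by
  powers of the prime element \<open>x\<close>.

  The surface is reduced because \<open>f\<close> is linear in \<open>z\<close> with leading coefficient a power of \<open>x\<close>: if
  \<open>h\<^sup>2\<close> divides \<open>f\<close>, then \<open>h\<close> divides \<open>f\<^sub>z = x\<^bsup>n+9\<^esup>\<close>. As \<open>f \<equiv> y\<^bsup>n+10\<^esup>\<close> modulo \<open>x\<close>, the prime
  \<open>x\<close> does not divide \<open>h\<close>, so \<open>h\<close> is a unit.

  The partial derivatives of \<open>f\<close> are
  \<open>f\<^sub>x = x\<^bsup>n+4\<^esup> G\<close> with \<open>G \<equiv> (n + 5) y\<^sup>5\<close> modulo \<open>x\<close>,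
  \<open>f\<^sub>y \<equiv> (n + 10) y\<^bsup>n+9\<^esup>\<close> modulo \<open>x\<close>,
  \<open>f\<^sub>z = x\<^bsup>n+9\<^esup>\<close> and \<open>f\<^sub>w = x\<^bsup>n+8\<^esup> y\<close>.
  Let \<open>(a, b, c, e)\<close> be a syzygy. All of \<open>f\<^sub>x, f\<^sub>z, f\<^sub>w\<close> are divisible by \<open>x\<^bsup>n+4\<^esup>\<close> while \<open>f\<^sub>y\<close> is
  prime to \<open>x\<close>, so \<open>x\<^bsup>n+4\<^esup>\<close> divides \<open>b\<close>. If \<open>b = 0\<close>, cancelling \<open>x\<^bsup>n+4\<^esup>\<close> leaves
  \<open>a G + c x\<^sup>5 + e x\<^sup>4 y = 0\<close>, so \<open>x\<^sup>4\<close> divides \<open>a\<close>. If also \<open>a = 0\<close>, then \<open>c x + e y = 0\<close>, and the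
  syzygy is a multiple of \<open>(0, 0, y, -x)\<close>. Each of these lower bounds is attained by an explicit
  syzygy: one with \<open>b\<close> a constant times \<open>x\<^bsup>n+4\<^esup>\<close>, one with \<open>b = 0\<close> and \<open>a = x\<^sup>4\<close>, and
  \<open>(0, 0, y, -x)\<close>. Their degrees are \<open>n + 4 = d - 6\<close>, \<open>4\<close> and \<open>1\<close>. Being in triangular form
  with respect to \<open>b\<close>, \<open>a\<close>, \<open>(c, e)\<close>, they generate all syzygies (lemma \<open>AR_generated\<close>) and are
  independent (lemma \<open>syz_independent_coeffs\<close>).
\<close>

section \<open>Divisibility by a variable\<close>

lemma mpoly4_induct [case_names monom add]:
  fixes p :: mpoly4
  assumes monom: "\<And>m c. P (Poly_Mapping.single m c)"
    and add: "\<And>p q. P p \<Longrightarrow> P q \<Longrightarrow> P (p + q)"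
  shows "P p"
proof (induction p rule: update_induct)
  case const
  show ?case using monom[of 0 0] by simp
next
  case (update p m c)
  have "Poly_Mapping.update m c p = Poly_Mapping.single m c + p"
    using update(1)
    by (intro poly_mapping_eqI)
       (auto simp: lookup_update lookup_add lookup_single when_def in_keys_iff)
  then show ?case using add[OF monom update(3)] by simp
qed

lemma lookup_pos_if_var_dvd:
  assumes "var i dvd p" and "m \<in> Poly_Mapping.keys p"
  shows "Poly_Mapping.lookup m i > 0"
proof -
  obtain q where "p = var i * q" using assms(1) by blast
  then obtain a b where "m = a + b" "a \<in> Poly_Mapping.keys (var i)"
    using assms(2) keys_mult[of "var i" q] by blast
  then show ?thesis by (simp add: var_def lookup_add)
qed

text \<open>
  A concrete form of the quotient by a variable: the remainders free of \<open>var i\<close> are closed under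
  products, and none of them but \<open>0\<close> is divisible by \<open>var i\<close>. Since polynomials have no zero
  divisors, this makes \<open>var i\<close> prime.
\<close>

lemma ex_remainder_var:
  fixes p :: mpoly4
  shows "\<exists>q r. p = var i * q + r \<and> (\<forall>m\<in>Poly_Mapping.keys r. Poly_Mapping.lookup m i = 0)"
proof (induction p rule: mpoly4_induct)
  case (monom m c)
  show ?case
  proof (cases "Poly_Mapping.lookup m i = 0")
    case True
    then show ?thesis by (intro exI[of _ 0] exI[of _ "Poly_Mapping.single m c"]) simp
  next
    case False
    then have "Poly_Mapping.single i 1 + (m - Poly_Mapping.single i 1) = m"
      by (intro poly_mapping_eqI)
         (auto simp: lookup_add minus_poly_mapping.rep_eq lookup_single when_def)
    then have "Poly_Mapping.single m c
        = var i * Poly_Mapping.single (m - Poly_Mapping.single i 1) c + 0"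
      by (simp add: var_def mult_single)
    then show ?thesis by (metis empty_iff keys_zero)
  qed
next
  case (add p p')
  then obtain q r q' r' where
    "p = var i * q + r" "\<forall>m\<in>Poly_Mapping.keys r. Poly_Mapping.lookup m i = 0"
    "p' = var i * q' + r'" "\<forall>m\<in>Poly_Mapping.keys r'. Poly_Mapping.lookup m i = 0"
    by blast
  then have "p + p' = var i * (q + q') + (r + r') \<and>
      (\<forall>m\<in>Poly_Mapping.keys (r + r'). Poly_Mapping.lookup m i = 0)"
    using keys_add[of r r'] by (auto simp: algebra_simps)
  then show ?case by blast
qed

lemma prime_elem_var: "prime_elem (var i)"
proof (rule prime_elemI)
  show "var i \<noteq> 0" by (simp add: var_def flip: keys_eq_empty)
  show "\<not> var i dvd 1" using lookup_pos_if_var_dvd[of i 1 0] by auto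
  fix a b :: mpoly4
  assume dvd: "var i dvd a * b"
  obtain q r where a: "a = var i * q + r" "\<forall>m\<in>Poly_Mapping.keys r. Poly_Mapping.lookup m i = 0"
    using ex_remainder_var by blast
  obtain q' r' where b: "b = var i * q' + r'" "\<forall>m\<in>Poly_Mapping.keys r'. Poly_Mapping.lookup m i = 0"
    using ex_remainder_var by blast
  have "a * b = var i * (q * b + r * q') + r * r'" by (simp add: a b algebra_simps)
  then have dvd': "var i dvd r * r'" using dvd by (metis dvd_add_right_iff dvd_triv_left)
  have "Poly_Mapping.keys (r * r') = {}"
  proof (rule ccontr)
    assume "Poly_Mapping.keys (r * r') \<noteq> {}"
    then obtain m where m: "m \<in> Poly_Mapping.keys (r * r')" by blast
    then obtain k l where "m = k + l" "k \<in> Poly_Mapping.keys r" "l \<in> Poly_Mapping.keys r'"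
      using keys_mult[of r r'] by blast
    then have "Poly_Mapping.lookup m i = 0" using a b by (simp add: lookup_add)
    then show False using lookup_pos_if_var_dvd[OF dvd' m] by simp
  qed
  then have "r = 0 \<or> r' = 0" by (metis keys_eq_empty no_zero_divisors)
  then show "var i dvd a \<or> var i dvd b" using a b by auto
qed

lemma not_var_dvd_var: "i \<noteq> j \<Longrightarrow> \<not> var i dvd var j"
  using lookup_pos_if_var_dvd[of i "var j" "Poly_Mapping.single j 1"]
  by (auto simp: var_def lookup_single)

lemma not_var_dvd_of_nat: "c > 0 \<Longrightarrow> \<not> var i dvd of_nat c"
  using lookup_pos_if_var_dvd[of i "of_nat c" 0] by (auto simp: in_keys_iff lookup_of_nat)

lemma not_var_dvd_of_nat_mult_power:
  assumes "i \<noteq> j" "c > 0"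
  shows "\<not> var i dvd of_nat c * var j ^ k"
  using assms not_var_dvd_var not_var_dvd_of_nat prime_elem_dvd_mult_iff prime_elem_dvd_power
    prime_elem_var by blast

lemma power_dvd_if_not_dvd_right:
  fixes p a b :: mpoly4
  assumes p: "prime_elem p" and dvd: "p ^ n dvd a * b" and b: "\<not> p dvd b"
  shows "p ^ n dvd a"
  using dvd
proof (induction n arbitrary: a)
  case 0
  show ?case by simp
next
  case (Suc n)
  have "p dvd p ^ Suc n" by simp
  then have "p dvd a * b" using Suc.prems by (rule dvd_trans)
  then have "p dvd a" using p b by (simp only: prime_elem_dvd_mult_iff simp_thms)
  then obtain a' where a: "a = p * a'" by (rule dvdE)
  have "p \<noteq> 0" using p by (rule prime_elem_not_zeroI)
  moreover have "p * p ^ n dvd p * (a' * b)" using Suc.prems by (simp only: a power_Suc mult.assoc)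
  ultimately have "p ^ n dvd a' * b" by (simp only: dvd_mult_cancel_left simp_thms)
  then have "p ^ n dvd a'" by (rule Suc.IH)
  then show ?case unfolding a power_Suc by (rule mult_dvd_mono[OF dvd_refl])
qed

lemma of_nat_unit:
  assumes "c > 0" shows "\<exists>u :: mpoly4. of_nat c * u = 1"
proof
  show "of_nat c * Poly_Mapping.single 0 (1 / of_nat c) = (1 :: mpoly4)"
    using assms by (simp add: mult_single flip: single_of_nat)
qed

section \<open>Partial derivatives\<close>

lemma partial_deriv_single:
  "partial_deriv i (Poly_Mapping.single m c) =
    Poly_Mapping.single (m - Poly_Mapping.single i 1) (of_nat (Poly_Mapping.lookup m i) * c)"
  by (simp add: partial_deriv_def)

lemma partial_deriv_add: "partial_deriv i (p + q) = partial_deriv i p + partial_deriv i q"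
  unfolding partial_deriv_def
  by (rule setsum_keys_plus_distrib) (simp_all add: distrib_left single_add)

lemma partial_deriv_mult_single:
  "partial_deriv i (Poly_Mapping.single k a * Poly_Mapping.single l b) =
    partial_deriv i (Poly_Mapping.single k a) * Poly_Mapping.single l b
    + Poly_Mapping.single k a * partial_deriv i (Poly_Mapping.single l b)"
proof -
  let ?e = "Poly_Mapping.single i (1::nat)"
  have shift: "k' + l' - ?e = k' - ?e + l'" if "Poly_Mapping.lookup k' i > 0" for k' l' :: "4 \<Rightarrow>\<^sub>0 nat"
    using that by (intro poly_mapping_eqI)
      (auto simp: lookup_add minus_poly_mapping.rep_eq lookup_single when_def)
  have "Poly_Mapping.single (k + l - ?e) (of_nat (Poly_Mapping.lookup k i) * a * b)
      = Poly_Mapping.single (k - ?e + l) (of_nat (Poly_Mapping.lookup k i) * a * b)"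
    using shift[of k l] by (cases "Poly_Mapping.lookup k i = 0") simp_all
  moreover have "Poly_Mapping.single (k + l - ?e) (a * (of_nat (Poly_Mapping.lookup l i) * b))
      = Poly_Mapping.single (k + (l - ?e)) (a * (of_nat (Poly_Mapping.lookup l i) * b))"
    using shift[of l k]
    by (cases "Poly_Mapping.lookup l i = 0") (simp_all add: add.commute)
  moreover have "partial_deriv i (Poly_Mapping.single k a * Poly_Mapping.single l b)
      = Poly_Mapping.single (k + l - ?e) (of_nat (Poly_Mapping.lookup k i) * a * b)
        + Poly_Mapping.single (k + l - ?e) (a * (of_nat (Poly_Mapping.lookup l i) * b))"
    by (simp add: mult_single partial_deriv_single lookup_add algebra_simps flip: single_add)
  ultimately show ?thesis
    by (simp only: mult_single partial_deriv_single)
qed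

lemma partial_deriv_mult: "partial_deriv i (p * q) = partial_deriv i p * q + p * partial_deriv i q"
proof (induction p rule: mpoly4_induct)
  case (monom k a)
  show ?case
  proof (induction q rule: mpoly4_induct)
    case (monom l b)
    show ?case by (rule partial_deriv_mult_single)
  qed (simp add: partial_deriv_add algebra_simps)
qed (simp add: partial_deriv_add algebra_simps)

lemma partial_deriv_power:
  assumes "k > 0"
  shows "partial_deriv i (p ^ k) = of_nat k * p ^ (k - 1) * partial_deriv i p"
proof -
  have "partial_deriv i (p ^ Suc n) = of_nat (Suc n) * p ^ n * partial_deriv i p" for n
    by (induction n) (simp_all add: partial_deriv_mult algebra_simps)
  then show ?thesis using assms by (metis Suc_diff_1)
qed

lemma partial_deriv_var: "partial_deriv i (var j) = (if i = j then 1 else 0)"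
  by (simp add: var_def partial_deriv_single lookup_single)

section \<open>Homogeneous polynomials\<close>

lemma homogeneous_poly_var: "homogeneous_poly 1 (var i)"
  by (simp add: homogeneous_poly_def var_def lookup_single when_def)

lemma homogeneous_poly_of_nat: "homogeneous_poly 0 (of_nat c)"
  by (auto simp: homogeneous_poly_def lookup_of_nat in_keys_iff)

lemma homogeneous_poly_0: "homogeneous_poly k 0"
  by (simp add: homogeneous_poly_def)

lemma homogeneous_poly_add:
  "homogeneous_poly k p \<Longrightarrow> homogeneous_poly k q \<Longrightarrow> homogeneous_poly k (p + q)"
  unfolding homogeneous_poly_def using keys_add[of p q] by blast

lemma homogeneous_poly_uminus: "homogeneous_poly k p \<Longrightarrow> homogeneous_poly k (- p)"
  by (simp add: homogeneous_poly_def in_keys_iff)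

lemma homogeneous_poly_diff:
  "homogeneous_poly k p \<Longrightarrow> homogeneous_poly k q \<Longrightarrow> homogeneous_poly k (p - q)"
  using homogeneous_poly_add[of k p "- q"] homogeneous_poly_uminus[of k q] by simp

lemma homogeneous_poly_mult:
  assumes "homogeneous_poly k p" "homogeneous_poly l q" "j = k + l"
  shows "homogeneous_poly j (p * q)"
  unfolding homogeneous_poly_def
proof
  fix m assume "m \<in> Poly_Mapping.keys (p * q)"
  then obtain a b where "m = a + b" "a \<in> Poly_Mapping.keys p" "b \<in> Poly_Mapping.keys q"
    using keys_mult[of p q] by blast
  then show "(\<Sum>i\<in>UNIV. Poly_Mapping.lookup m i) = j"
    using assms by (simp add: homogeneous_poly_def lookup_add sum.distrib)
qed

lemma homogeneous_poly_var_power: "homogeneous_poly k (var i ^ k)"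
proof (induction k)
  case 0
  show ?case using homogeneous_poly_of_nat[of 1] by simp
next
  case (Suc k)
  show ?case using homogeneous_poly_mult[OF homogeneous_poly_var Suc] by simp
qed

lemmas homogeneous_poly_intros = homogeneous_poly_var homogeneous_poly_of_nat homogeneous_poly_0
  homogeneous_poly_add homogeneous_poly_uminus homogeneous_poly_diff homogeneous_poly_mult
  homogeneous_poly_var_power

section \<open>The surface\<close>

text \<open>
  Substituting \<open>n + 10\<close> for \<open>d\<close> removes the truncated subtractions from the exponents.
\<close>

lemma surface_poly_shift:
  "surface_poly (n + 10) = X ^ (n + 9) * Z + Y ^ (n + 10) + X ^ (n + 8) * Y * W + X ^ (n + 5) * Y ^ 5"
  by (simp add: surface_poly_def add.commute)

lemma partial_deriv_surface_poly:
  shows "partial_deriv 1 (surface_poly (n + 10)) = X ^ (n + 4) *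
      (of_nat (n + 9) * X ^ 4 * Z + of_nat (n + 8) * X ^ 3 * Y * W + of_nat (n + 5) * Y ^ 5)"
    and "partial_deriv 2 (surface_poly (n + 10)) =
      of_nat (n + 10) * Y ^ (n + 9) + X ^ (n + 8) * W + 5 * X ^ (n + 5) * Y ^ 4"
    and "partial_deriv 3 (surface_poly (n + 10)) = X ^ (n + 9)"
    and "partial_deriv 4 (surface_poly (n + 10)) = X ^ (n + 8) * Y"
  unfolding surface_poly_shift
  by (simp_all add: partial_deriv_add partial_deriv_mult partial_deriv_power partial_deriv_var,
      simp_all add: power_add algebra_simps eval_nat_numeral)

lemma X_not_dvd_surface_poly: "\<not> X dvd surface_poly (n + 10)"
proof
  assume "X dvd surface_poly (n + 10)"
  moreover have "surface_poly (n + 10) = of_nat 1 * Y ^ (n + 10)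
      + X * (X ^ (n + 8) * Z + X ^ (n + 7) * Y * W + X ^ (n + 4) * Y ^ 5)"
    unfolding surface_poly_shift by (simp add: power_add algebra_simps eval_nat_numeral)
  ultimately have "X dvd of_nat 1 * Y ^ (n + 10)" by (metis dvd_add_left_iff dvd_triv_left)
  then show False using not_var_dvd_of_nat_mult_power[of 1 2 1 "n + 10"] by simp
qed

text \<open>
  By the Leibniz rule a square factor of \<open>f\<close> shares its root with every partial derivative; the
  derivative along \<open>z\<close> is a mere power of \<open>x\<close>.
\<close>

lemma squarefree_surface_poly: "squarefree (surface_poly (n + 10))"
proof (rule squarefreeI)
  fix h :: mpoly4
  assume "h\<^sup>2 dvd surface_poly (n + 10)"
  then obtain g where g: "surface_poly (n + 10) = h * (h * g)"
    by (metis dvdE mult.assoc power2_eq_square)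
  then have "X ^ (n + 9) = h * (2 * partial_deriv 3 h * g + h * partial_deriv 3 g)"
    using partial_deriv_surface_poly(3)[of n] by (simp add: partial_deriv_mult algebra_simps)
  then obtain k where k: "X ^ (n + 9) = k * h" by (metis mult.commute)
  \<comment> \<open>The prime \<open>x\<close> does not divide \<open>h\<close>, so its full power must sit in the cofactor \<open>k\<close>, which
    leaves no room in \<open>h\<close> for anything but a unit.\<close>
  have "\<not> X dvd h" using g X_not_dvd_surface_poly by (metis dvd_mult2)
  then have "X ^ (n + 9) dvd k"
    using power_dvd_if_not_dvd_right[OF prime_elem_var, of 1 "n + 9" k h] k by simp
  then obtain u where "k = X ^ (n + 9) * u" by blast
  with k have "X ^ (n + 9) * (u * h) = X ^ (n + 9) * 1" by (simp add: mult.assoc)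
  moreover have "X ^ (n + 9) \<noteq> 0" using prime_elem_not_zeroI[OF prime_elem_var] by simp
  ultimately have "u * h = 1" using mult_cancel_left by blast
  then show "h dvd 1" by (metis dvd_triv_right)
qed

lemma homogeneous_surface_poly: "homogeneous_poly (n + 10) (surface_poly (n + 10))"
  unfolding surface_poly_shift by (rule homogeneous_poly_intros | simp)+

section \<open>Jacobian syzygies\<close>

definition vec4 :: "mpoly4 \<Rightarrow> mpoly4 \<Rightarrow> mpoly4 \<Rightarrow> mpoly4 \<Rightarrow> mpoly4 ^ 4" where
  "vec4 a b c e = (\<chi> i. if i = 1 then a else if i = 2 then b else if i = 3 then c else e)"

lemma vec4_nth [simp]:
  "vec4 a b c e $ 1 = a" "vec4 a b c e $ 2 = b" "vec4 a b c e $ 3 = c" "vec4 a b c e $ 4 = e"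
  by (simp_all add: vec4_def)

text \<open>
  The Koszul relation between \<open>f\<^sub>z = x\<^bsup>n+8\<^esup> x\<close> and \<open>f\<^sub>w = x\<^bsup>n+8\<^esup> y\<close>.
\<close>

definition syz_linear :: "mpoly4 ^ 4" where
  "syz_linear = vec4 0 0 Y (- X)"

text \<open>
  Since \<open>x\<^sup>4 f\<^sub>x = x\<^bsup>n+8\<^esup> G\<close> and \<open>G\<close> lies in the ideal \<open>(x, y)\<close>, this multiple of \<open>f\<^sub>x\<close> is a combination
  of \<open>f\<^sub>z\<close> and \<open>f\<^sub>w\<close>.
\<close>

definition syz_quartic :: "nat \<Rightarrow> mpoly4 ^ 4" where
  "syz_quartic n = vec4 (X ^ 4) 0
     (- (of_nat (n + 9) * X ^ 3 * Z + of_nat (n + 8) * X ^ 2 * Y * W))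
     (- (of_nat (n + 5) * Y ^ 4))"

text \<open>
  Here \<open>b\<close> is a multiple of \<open>x\<^bsup>n+4\<^esup>\<close>, and \<open>a\<close> has to satisfy
  \<open>a G + b' (n + 10) y\<^bsup>n+9\<^esup> \<equiv> 0\<close> modulo \<open>x\<^sup>4\<close>, where \<open>b = x\<^bsup>n+4\<^esup> b'\<close> and
  \<open>G \<equiv> y ((n + 8) x\<^sup>3 w + (n + 5) y\<^sup>4)\<close>. The term \<open>- (n + 10) y\<^bsup>n+4\<^esup>\<close> of \<open>a\<close> cancels
  \<open>y\<^bsup>n+9\<^esup>\<close> when \<open>b' = n + 5\<close>, and the term in \<open>x\<^sup>3 y\<^sup>n w\<close> cancels the cross term
  \<open>x\<^sup>3 y\<^bsup>n+5\<^esup> w\<close> that the first one produces; its factor \<open>y\<^sup>n = y\<^bsup>d-10\<^esup>\<close> is the reason for \<open>d \<ge> 10\<close>.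
  A further factor \<open>n + 5\<close> clears denominators. What remains lies in \<open>x\<^sup>4 (x, y)\<close> and is absorbed
  by \<open>c\<close> and \<open>e\<close>.
\<close>

definition syz_top :: "nat \<Rightarrow> mpoly4 ^ 4" where
  "syz_top n = vec4
     (of_nat ((n + 10) * (n + 8)) * X ^ 3 * Y ^ n * W - of_nat ((n + 10) * (n + 5)) * Y ^ (n + 4))
     (of_nat ((n + 5)\<^sup>2) * X ^ (n + 4))
     (- (of_nat ((n + 10) * (n + 9) * (n + 8)) * X ^ 2 * Y ^ n * Z * W
        + of_nat ((n + 10) * (n + 8)\<^sup>2) * X * Y ^ (n + 1) * W ^ 2
        + of_nat ((n + 5)\<^sup>2) * X ^ (n + 3) * W
        + of_nat (5 * (n + 5)\<^sup>2) * X ^ n * Y ^ 4))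
     (of_nat ((n + 10) * (n + 9) * (n + 5)) * Y ^ (n + 3) * Z)"

lemma mem_AR_iff: "v \<in> AR f \<longleftrightarrow> v $ 1 * partial_deriv 1 f + v $ 2 * partial_deriv 2 f
    + v $ 3 * partial_deriv 3 f + v $ 4 * partial_deriv 4 f = 0"
  by (simp only: AR_def mem_Collect_eq sum_4)

lemma syz_in_AR:
  shows "syz_linear \<in> AR (surface_poly (n + 10))"
    and "syz_quartic n \<in> AR (surface_poly (n + 10))"
    and "syz_top n \<in> AR (surface_poly (n + 10))"
proof -
  have pow: "p ^ (n + numeral k) = p ^ n * p ^ numeral k" for p :: mpoly4 and k by (simp add: power_add)
  show "syz_linear \<in> AR (surface_poly (n + 10))"
    unfolding mem_AR_iff partial_deriv_surface_poly syz_linear_def vec4_nth pow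
    by (simp add: algebra_simps eval_nat_numeral)
  show "syz_quartic n \<in> AR (surface_poly (n + 10))"
    unfolding mem_AR_iff partial_deriv_surface_poly syz_quartic_def vec4_nth pow
    by (simp add: algebra_simps eval_nat_numeral)
  show "syz_top n \<in> AR (surface_poly (n + 10))"
    unfolding mem_AR_iff partial_deriv_surface_poly syz_top_def vec4_nth pow
      of_nat_add of_nat_mult of_nat_power of_nat_numeral power_add power_one_right
    by algebra
qed

lemma homogeneous_syz:
  shows "homogeneous_vec 1 syz_linear"
    and "homogeneous_vec 4 (syz_quartic n)"
    and "homogeneous_vec (n + 4) (syz_top n)"
  unfolding homogeneous_vec_def forall_4 syz_linear_def syz_quartic_def syz_top_def vec4_nth
  by (intro conjI; (rule homogeneous_poly_intros | simp)+)+

text \<open>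
  Triangular reduction: subtracting a multiple of \<open>syz_top\<close> kills the second component of a syzygy,
  a multiple of \<open>syz_quartic\<close> then kills the first, and what is left is a multiple of \<open>syz_linear\<close>.
\<close>

lemma AR_generated:
  assumes v: "v \<in> AR (surface_poly (n + 10))"
  shows "\<exists>p q r. v = p *s syz_linear + q *s syz_quartic n + r *s syz_top n"
proof -
  let ?f = "surface_poly (n + 10)"
  have X0: "X \<noteq> 0" using prime_elem_not_zeroI[OF prime_elem_var] .
  define G where "G = of_nat (n + 9) * X ^ 4 * Z + of_nat (n + 8) * X ^ 3 * Y * W + of_nat (n + 5) * Y ^ 5"
  have fx: "partial_deriv 1 ?f = X ^ (n + 4) * G"
    using partial_deriv_surface_poly(1) G_def by simp
  have "\<not> X dvd partial_deriv 2 ?f"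
  proof
    assume "X dvd partial_deriv 2 ?f"
    moreover have "partial_deriv 2 ?f = of_nat (n + 10) * Y ^ (n + 9)
        + X * (X ^ (n + 7) * W + 5 * X ^ (n + 4) * Y ^ 4)"
      unfolding partial_deriv_surface_poly by (simp add: power_add algebra_simps eval_nat_numeral)
    ultimately have "X dvd of_nat (n + 10) * Y ^ (n + 9)" by (metis dvd_add_left_iff dvd_triv_left)
    then show False using not_var_dvd_of_nat_mult_power[of 1 2 "n + 10" "n + 9"] by simp
  qed
  moreover have "X ^ (n + 4) dvd v $ 2 * partial_deriv 2 ?f"
  proof -
    have "v $ 2 * partial_deriv 2 ?f + X ^ (n + 4) * (v $ 1 * G + v $ 3 * X ^ 5 + v $ 4 * X ^ 4 * Y) = 0"
      using v unfolding mem_AR_iff fx partial_deriv_surface_poly(3,4)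
      by (simp add: power_add algebra_simps eval_nat_numeral)
    then have "v $ 2 * partial_deriv 2 ?f
        = X ^ (n + 4) * (- (v $ 1 * G + v $ 3 * X ^ 5 + v $ 4 * X ^ 4 * Y))"
      by (simp only: eq_neg_iff_add_eq_0 mult_minus_right)
    then show ?thesis by (metis dvd_triv_left)
  qed
  ultimately have "X ^ (n + 4) dvd v $ 2"
    using power_dvd_if_not_dvd_right[OF prime_elem_var] by blast
  then obtain b where b: "v $ 2 = X ^ (n + 4) * b" by blast
  \<comment> \<open>The second component of \<open>syz_top\<close> is \<open>x\<^bsup>n+4\<^esup>\<close> only up to this integer factor, which is
    invertible over the complex numbers.\<close>
  obtain u :: mpoly4 where u: "of_nat ((n + 5)\<^sup>2) * u = 1"
    using of_nat_unit[of "(n + 5)\<^sup>2"] by auto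
  define r where "r = u * b"
  define v' where "v' = v - r *s syz_top n"
  have v': "v' \<in> AR ?f"
    unfolding v'_def
    by (intro mpoly4_vec.subspace_diff mpoly4_vec.subspace_scale subspace_AR v syz_in_AR)
  have "v' $ 2 = X ^ (n + 4) * b - of_nat ((n + 5)\<^sup>2) * u * (X ^ (n + 4) * b)"
    by (simp add: v'_def r_def syz_top_def b algebra_simps del: of_nat_power of_nat_add)
  then have v'2: "v' $ 2 = 0" by (simp add: u del: of_nat_power of_nat_add)
  have "X ^ (n + 4) * (v' $ 1 * G + v' $ 3 * X ^ 5 + v' $ 4 * X ^ 4 * Y) = 0"
    using v' unfolding mem_AR_iff fx partial_deriv_surface_poly(3,4) v'2
    by (simp add: power_add algebra_simps eval_nat_numeral)
  then have rel: "v' $ 1 * G + v' $ 3 * X ^ 5 + v' $ 4 * X ^ 4 * Y = 0"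
    using X0 by simp
  have "v' $ 1 * G = X ^ 4 * (- (v' $ 3 * X + v' $ 4 * Y))"
    using rel by algebra
  then have "X ^ 4 dvd v' $ 1 * G" by (metis dvd_triv_left)
  moreover have "\<not> X dvd G"
  proof
    assume "X dvd G"
    moreover have "G = of_nat (n + 5) * Y ^ 5
        + X * (of_nat (n + 9) * X ^ 3 * Z + of_nat (n + 8) * X ^ 2 * Y * W)"
      unfolding G_def by (simp add: algebra_simps eval_nat_numeral)
    ultimately have "X dvd of_nat (n + 5) * Y ^ 5" by (metis dvd_add_left_iff dvd_triv_left)
    then show False using not_var_dvd_of_nat_mult_power[of 1 2 "n + 5" 5] by simp
  qed
  ultimately have "X ^ 4 dvd v' $ 1"
    using power_dvd_if_not_dvd_right[OF prime_elem_var] by blast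
  then obtain q where q: "v' $ 1 = X ^ 4 * q" by blast
  define v'' where "v'' = v' - q *s syz_quartic n"
  have v'': "v'' \<in> AR ?f"
    unfolding v''_def
    by (intro mpoly4_vec.subspace_diff mpoly4_vec.subspace_scale subspace_AR v' syz_in_AR)
  have v''12: "v'' $ 1 = 0" "v'' $ 2 = 0"
    by (simp_all add: v''_def syz_quartic_def q v'2)
  have "X ^ (n + 8) * (v'' $ 3 * X + v'' $ 4 * Y) = 0"
    using v'' unfolding mem_AR_iff partial_deriv_surface_poly(3,4) v''12
    by (simp add: algebra_simps eval_nat_numeral)
  then have rel': "v'' $ 3 * X + v'' $ 4 * Y = 0" using X0 by simp
  then have "v'' $ 4 * Y = X * (- v'' $ 3)" by algebra
  then have "X dvd v'' $ 4 * Y" by (metis dvd_triv_left)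
  then have "X dvd v'' $ 4"
    using prime_elem_dvd_mult_iff[OF prime_elem_var] not_var_dvd_var[of 1 2] by simp
  then obtain t where t: "v'' $ 4 = X * t" by blast
  have "X * (v'' $ 3 + t * Y) = 0" using rel' unfolding t by algebra
  then have "v'' $ 3 = - t * Y" using X0 by (simp add: eq_neg_iff_add_eq_0)
  then have "v'' = (- t) *s syz_linear"
    by (simp add: vec_eq_iff forall_4 v''12 t syz_linear_def)
  then have "v = (- t) *s syz_linear + q *s syz_quartic n + r *s syz_top n"
    by (simp add: v''_def v'_def algebra_simps)
  then show ?thesis by blast
qed

text \<open>
  The triangular form again: the second, the first and the fourth component determine \<open>r\<close>, \<open>q\<close>
  and \<open>p\<close> in this order.
\<close>

lemma syz_independent_coeffs:
  assumes "p *s syz_linear + q *s syz_quartic n + r *s syz_top n = 0"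
  shows "p = 0" "q = 0" "r = 0"
proof -
  have X0: "X \<noteq> 0" using prime_elem_not_zeroI[OF prime_elem_var] .
  have comp: "p * syz_linear $ i + q * syz_quartic n $ i + r * syz_top n $ i = 0" for i
    using arg_cong[OF assms, of "\<lambda>v. v $ i"]
    by (simp only: vector_add_component vector_smult_component zero_index)
  have "(of_nat ((n + 5)\<^sup>2) :: mpoly4) \<noteq> 0" unfolding of_nat_eq_0_iff by simp
  then show r: "r = 0" using comp[of 2] X0
    by (simp add: syz_linear_def syz_quartic_def syz_top_def del: of_nat_power of_nat_add)
  show q: "q = 0" using comp[of 1] X0 by (simp add: syz_linear_def syz_quartic_def r)
  show "p = 0" using comp[of 4] X0 by (simp add: syz_linear_def q r)
qed

lemma homogeneous_basis_AR:
  "homogeneous_basis (AR (surface_poly (n + 10))) [syz_linear, syz_quartic n, syz_top n] [1, 4, n + 4]"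
proof -
  let ?S = "{syz_linear, syz_quartic n, syz_top n}"
  have ne: "syz_linear \<noteq> syz_quartic n" "syz_linear \<noteq> syz_top n" "syz_quartic n \<noteq> syz_top n"
    using syz_independent_coeffs(1)[of 1 "-1" n 0] syz_independent_coeffs(1)[of 1 0 n "-1"]
      syz_independent_coeffs(2)[of 0 1 n "-1"] by auto
  have "mpoly4_vec.independent ?S"
    using ne syz_independent_coeffs[of _ _ n]
    by (auto simp: mpoly4_vec.dependent_finite add.assoc)
  moreover have "mpoly4_vec.span ?S = AR (surface_poly (n + 10))"
  proof
    show "mpoly4_vec.span ?S \<subseteq> AR (surface_poly (n + 10))"
      by (rule mpoly4_vec.span_minimal) (auto simp: syz_in_AR subspace_AR)
    show "AR (surface_poly (n + 10)) \<subseteq> mpoly4_vec.span ?S"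
    proof
      fix v assume "v \<in> AR (surface_poly (n + 10))"
      then obtain p q r where v: "v = p *s syz_linear + q *s syz_quartic n + r *s syz_top n"
        using AR_generated by blast
      show "v \<in> mpoly4_vec.span ?S"
        unfolding v by (intro mpoly4_vec.span_add mpoly4_vec.span_scale mpoly4_vec.span_base) auto
    qed
  qed
  ultimately show ?thesis
    using ne homogeneous_syz by (simp add: homogeneous_basis_def)
qed

theorem proposition4p11:
  fixes d :: nat
  assumes "d \<ge> 10"
  shows "free_surface (surface_poly d) \<and> has_exponents (surface_poly d) [1, 4, d - 6]"
proof -
  obtain n where d: "d = n + 10" using assms by (metis add.commute le_Suc_ex)
  have "reduced_surface (surface_poly d)"
    unfolding reduced_surface_def d
    using homogeneous_surface_poly squarefree_surface_poly by (metis add_gr_0 zero_less_numeral)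
  moreover have "homogeneous_basis (AR (surface_poly d)) [syz_linear, syz_quartic n, syz_top n] [1, 4, d - 6]"
    using homogeneous_basis_AR[of n] by (simp add: d add.commute)
  moreover have "length [syz_linear, syz_quartic n, syz_top n] = 3" by simp
  ultimately show ?thesis
    unfolding free_surface_def has_exponents_def by blast
qed

end
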